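(* For all integers $n,k$ with $n\ge k\ge 1$ and $n-k\ge 1$, the binomial Ward numbers of the second kind $S^\circ(n,k)$ satisfy $$S^\circ(n,k)=\frac{2n(2n-1)}{n+k}\left(\frac{k}{n-k}\,S^\circ(n-1,k)+S^\circ(n-1,k-1)\right),$$ with $S^\circ(0,0)=1$, $S^\circ(n,0)=0$ for $n\ge1$, $S^\circ(0,k)=0$ for $k\ge1$, and $S^\circ(n,k)=0$ for $k>n$.
   Context: Ward numbers of the second kind $S(n,k)$: defined for $n\ge k\ge 1$ by the recurrence $S(n,k)=k\,S(n-1,k)+(n+k-1)\,S(n-1,k-1)$, with $S(0,0)=1$, $S(n,0)=0$ for $n\ge 1$, $S(0,k)=0$ for $k\ge 1$, and $S(n,k)=0$ for $k>n$. Binomial Ward numbers of the second kind: for integers $n,k\ge 0$, $S^\circ(n,k)=\dbinom{2n}{n+k}S(n,k)$. *)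

theory Defs
  imports Complex_Main
begin

text \<open>Ward numbers of the second kind. The conditional in the last equation is the convention
  that \<open>S(n,k) = 0\<close> for \<open>k > n\<close>; the subtraction there never truncates.\<close>

fun ward2 :: "nat \<Rightarrow> nat \<Rightarrow> nat" where
  "ward2 0 0 = 1"
| "ward2 (Suc n) 0 = 0"
| "ward2 0 (Suc k) = 0"
| "ward2 (Suc n) (Suc k) =
     (if Suc k > Suc n then 0
      else Suc k * ward2 n (Suc k) + (Suc n + Suc k - 1) * ward2 n k)"

definition binomial_ward2 :: "nat \<Rightarrow> nat \<Rightarrow> nat" where
  "binomial_ward2 n k = ((2 * n) choose (n + k)) * ward2 n k"

end

theory Submission
  imports Defs
begin

text \<open>The two factors of the recurrence come from lowering the upper index of
  \<open>(2n choose n + k)\<close> by two, with the lower index lowered by one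
  for the term \<open>S(n - 1, k)\<close> and by two for the term \<open>S(n - 1, k - 1)\<close>; in the latter the factor
  \<open>n + k - 1\<close> of the Ward recurrence cancels.\<close>

text \<open>Two successive uses of the absorption identity, each lowering both indices by
  one.\<close>

lemma binomial_Suc_Suc_absorb2:
  "Suc (Suc b) * Suc b * (Suc (Suc a) choose Suc (Suc b)) = Suc (Suc a) * Suc a * (a choose b)"
proof -
  have "Suc (Suc b) * Suc b * (Suc (Suc a) choose Suc (Suc b))
      = Suc b * (Suc (Suc a) * (Suc a choose Suc b))"
    by (simp only: Suc_times_binomial mult.assoc mult.left_commute[of "Suc (Suc b)"])
  also have "\<dots> = Suc (Suc a) * Suc a * (a choose b)"
    by (simp only: Suc_times_binomial mult.assoc mult.left_commute[of "Suc b"])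
  finally show ?thesis .
qed

text \<open>Absorption lowers both indices once; the complementary form then lowers the upper index
  alone. Truncated subtraction is harmless: for \<open>b > a\<close> both sides vanish.\<close>

lemma binomial_Suc_Suc_absorb_both:
  "Suc b * (Suc a - b) * (Suc (Suc a) choose Suc b) = Suc (Suc a) * Suc a * (a choose b)"
proof -
  have "Suc b * (Suc a - b) * (Suc (Suc a) choose Suc b)
      = (Suc a - b) * (Suc (Suc a) * (Suc a choose b))"
    by (simp only: Suc_times_binomial mult.assoc mult.left_commute[of "Suc b"])
  also have "\<dots> = Suc (Suc a) * ((Suc a - b) * (Suc a choose b))"
    by (simp only: mult.left_commute)
  also have "\<dots> = Suc (Suc a) * Suc a * (a choose b)"
    by (simp only: binomial_absorb_comp diff_Suc_1 mult.assoc)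
  finally show ?thesis .
qed

text \<open>Shifting to \<open>n = Suc m\<close>, \<open>k = Suc j\<close> lets the last equation of
  \<open>ward2\<close> unfold directly; the strict \<open>j < m\<close> keeps the denominator
  \<open>n - k\<close> positive.\<close>

lemma binomial_ward2_rec:
  assumes "j < m"
  shows "real (binomial_ward2 (Suc m) (Suc j)) =
    2 * real (Suc m) * (2 * real (Suc m) - 1) / (real (Suc m) + real (Suc j)) *
      (real (Suc j) / (real (Suc m) - real (Suc j)) * real (binomial_ward2 m (Suc j))
       + real (binomial_ward2 m j))"
proof -
  \<comment> \<open>With \<open>n = Suc m\<close> and \<open>k = Suc j\<close>, the binomials
    \<open>c\<close>, \<open>p\<close>, \<open>q\<close> multiply S(n,k), S(n-1,k) and S(n-1,k-1);
    \<open>t\<close> is 2n(2n-1) and \<open>u\<close> is n+k.\<close>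
  define c where "c = real (Suc (Suc (2 * m)) choose Suc (Suc (m + j)))"
  define p where "p = real (2 * m choose Suc (m + j))"
  define q where "q = real (2 * m choose (m + j))"
  define t where "t = (2 * real m + 2) * (2 * real m + 1)"
  define u where "u = real m + real j + 2"
  have pos: "u > 0" "u - 1 > 0" "real m - real j > 0"
    using assms by (auto simp: u_def)
  have "real (Suc (Suc (m + j))) * real (Suc (2 * m) - Suc (m + j)) * c
      = real (Suc (Suc (2 * m)) * Suc (2 * m)) * p"
    unfolding c_def p_def of_nat_mult[symmetric] binomial_Suc_Suc_absorb_both ..
  \<comment> \<open>This difference is n-k, the source of the denominator in the first term.\<close>
  moreover have "real (Suc (2 * m) - Suc (m + j)) = real m - real j"
    using assms by (simp add: of_nat_diff)
  moreover have "real (Suc (Suc (m + j))) = u" "real (Suc (Suc (2 * m)) * Suc (2 * m)) = t"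
    by (simp_all add: t_def u_def algebra_simps)
  ultimately have "u * (real m - real j) * c = t * p"
    by (simp only:)
  then have p: "c = t / u * (p / (real m - real j))"
    using pos by (simp add: field_simps)
  have "real (Suc (Suc (m + j)) * Suc (m + j)) * c = real (Suc (Suc (2 * m)) * Suc (2 * m)) * q"
    unfolding c_def q_def of_nat_mult[symmetric] binomial_Suc_Suc_absorb2 ..
  then have "u * (u - 1) * c = t * q"
    by (simp add: t_def u_def algebra_simps)
  \<comment> \<open>The factor \<open>u - 1\<close> stays on the left: it is exactly the weight
    n+k-1 that the Ward recurrence puts on S(n-1,k-1).\<close>
  then have q: "(u - 1) * c = t / u * q"
    using pos by (simp add: field_simps)
  have "real (binomial_ward2 (Suc m) (Suc j))
      = real (Suc j) * real (ward2 m (Suc j)) * c + real (ward2 m j) * ((u - 1) * c)"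
    using assms by (simp add: binomial_ward2_def c_def u_def algebra_simps)
  also have "\<dots> = t / u * (real (Suc j) / (real m - real j) * (p * real (ward2 m (Suc j)))
      + q * real (ward2 m j))"
    \<comment> \<open>Rewriting \<open>(u - 1) * c\<close> as a whole by \<open>q\<close> first
      leaves a single \<open>c\<close>, in the first summand, for \<open>p\<close>.\<close>
    unfolding q by (subst p) (simp add: distrib_left mult_ac del: of_nat_Suc)
  finally show ?thesis
    by (simp add: binomial_ward2_def p_def q_def t_def u_def algebra_simps)
qed

lemma ward2_eq_0: "n < k \<Longrightarrow> ward2 n k = 0"
  by (induction n k rule: ward2.induct) auto

theorem theorem5p3:
  shows "(\<forall>n k :: nat. n \<ge> k \<and> k \<ge> 1 \<and> n - k \<ge> 1 \<longrightarrow>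
            real (binomial_ward2 n k) =
              2 * real n * (2 * real n - 1) / (real n + real k) *
              (real k / (real n - real k) * real (binomial_ward2 (n - 1) k)
               + real (binomial_ward2 (n - 1) (k - 1))))
       \<and> binomial_ward2 0 0 = 1
       \<and> (\<forall>n::nat. n \<ge> 1 \<longrightarrow> binomial_ward2 n 0 = 0)
       \<and> (\<forall>k::nat. k \<ge> 1 \<longrightarrow> binomial_ward2 0 k = 0)
       \<and> (\<forall>n k :: nat. k > n \<longrightarrow> binomial_ward2 n k = 0)"
proof (intro conjI allI impI)
  fix n k :: nat
  assume nk: "n \<ge> k \<and> k \<ge> 1 \<and> n - k \<ge> 1"
  then obtain m j where "n = Suc m" "k = Suc j"
    by (metis One_nat_def Suc_le_D le_trans)
  moreover from this nk have "j < m"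
    by linarith
  ultimately show "real (binomial_ward2 n k) =
      2 * real n * (2 * real n - 1) / (real n + real k) *
      (real k / (real n - real k) * real (binomial_ward2 (n - 1) k)
       + real (binomial_ward2 (n - 1) (k - 1)))"
    using binomial_ward2_rec[of j m] by simp
next
  fix n :: nat
  assume "n \<ge> 1"
  then show "binomial_ward2 n 0 = 0"
    \<comment> \<open>The central binomial coefficient is nonzero here, so the zero comes from
      \<open>ward2 (Suc n) 0\<close>.\<close>
    by (cases n) (auto simp: binomial_ward2_def)
qed (auto simp: binomial_ward2_def ward2_eq_0)

end
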